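(* Let $A\in\mathbb{R}^{m\times d}$, $A\ne 0$, let $b\in\mathbb{R}^m$ be such that $Av=b$ is consistent, and let $\hat v\in\mathbb{R}^d$ satisfy $A\hat v=b$. Let $(v^k)_{k\ge0}$ be generated by the SGDAS iteration (described in the context) with random directions satisfying the isotropy assumption with constant $c$, and with constant stepsize $\tau_k=\tau$ where $$0<\tau<\frac{2}{c\|A\|^2}.$$ If $$\lambda:=\rho\left(I_d-\tau A^TA(2I_d-\tau c A^TA)\right)\in[0,1),$$ then for every $k\ge0$ $$\mathbb{E}\big(\|v^{k+1}-\hat v\|^2\big)\le\lambda^{k+1}\|v^0-\hat v\|^2 .$$
   Context: $\|\cdot\|$ is the Euclidean norm for vectors and the corresponding operator (spectral) norm for matrices; $\rho$ is the spectral radius (maximum magnitude of the eigenvalues). Isotropy assumption on the random direction $x\in\mathbb{R}^d$: $\mathbb{E}(xx^T)=I_d$ and $\mathbb{E}(xx^T\|x\|^2)=c\,I_d$ for some constant $c$. SGDAS: $v^0=0\in\mathbb{R}^d$ and, for $k=0,1,2,\dots$, draw a random vector $x=x^k$ (independent of the previous draws, with fixed distribution) and set $v^{k+1}=v^k-\tau_k\langle Av^k-b,Ax\rangle x$. $\mathbb{E}$ is the expectation over all involved randomness. *)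

theory Defs
  imports "HOL-Probability.Probability"
begin

definition outer_product :: "real^'d \<Rightarrow> real^'d \<Rightarrow> real^'d^'d" where
  "outer_product x y = (\<chi> i j. x $ i * y $ j)"

text \<open>
  The library's \<^term>\<open>norm A\<close> of a matrix is the Frobenius norm, not the norm induced by
  the Euclidean one.
\<close>

definition spectral_norm :: "real^'d^'m \<Rightarrow> real" where
  "spectral_norm A = onorm ((*v) A)"

text \<open>
  Complex eigenvalues are included, so the set below is finite and nonempty for every matrix.
\<close>

definition complex_eigenvalue :: "real^'d^'d \<Rightarrow> complex \<Rightarrow> bool" where
  "complex_eigenvalue M z \<longleftrightarrow>
     (\<exists>v::complex^'d. v \<noteq> 0 \<and> map_matrix complex_of_real M *v v = z *s v)"

definition matrix_spectral_radius :: "real^'d^'d \<Rightarrow> real" where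
  "matrix_spectral_radius M = Max (cmod ` {z. complex_eigenvalue M z})"

text \<open>
  Isotropy of a distribution \<open>D\<close> of directions.  Integrability is explicit because the integral
  of a non-integrable function is 0 by convention.
\<close>

definition isotropic :: "(real^'d) measure \<Rightarrow> real \<Rightarrow> bool" where
  "isotropic D c \<longleftrightarrow>
     integrable D (\<lambda>x. outer_product x x) \<and>
     (\<integral>x. outer_product x x \<partial>D) = mat 1 \<and>
     integrable D (\<lambda>x. (norm x)\<^sup>2 *\<^sub>R outer_product x x) \<and>
     (\<integral>x. (norm x)\<^sup>2 *\<^sub>R outer_product x x \<partial>D) = c *\<^sub>R mat 1"

primrec sgdas ::
  "real^'d^'m \<Rightarrow> real^'m \<Rightarrow> (nat \<Rightarrow> real) \<Rightarrow> (nat \<Rightarrow> real^'d) \<Rightarrow> nat \<Rightarrow> real^'d" where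
  "sgdas A b \<tau> x 0 = 0"
| "sgdas A b \<tau> x (Suc k) =
     sgdas A b \<tau> x k - (\<tau> k * ((A *v sgdas A b \<tau> x k - b) \<bullet> (A *v x k))) *\<^sub>R x k"

end

theory Submission
  imports Defs
begin

text \<open>
  Let \<open>e\<^sub>k = v\<^sub>k - vhat\<close> be the error and \<open>G = A\<^sup>T A\<close>.  As \<open>A vhat = b\<close>, one step with the
  direction \<open>x\<close> sends \<open>e\<close> to \<open>e - \<tau> \<langle>G e, x\<rangle> x\<close>, hence
  \<open>\<parallel>e\<parallel>\<^sup>2\<close> to \<open>\<parallel>e\<parallel>\<^sup>2 - 2 \<tau> \<langle>G e, x\<rangle> \<langle>x, e\<rangle> + \<tau>\<^sup>2 \<langle>G e, x\<rangle>\<^sup>2 \<parallel>x\<parallel>\<^sup>2\<close>.  The two moment conditions in the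
  isotropy assumption are exactly what is needed to average this over \<open>x\<close>; the result is
  \<open>\<parallel>e\<parallel>\<^sup>2 - 2 \<tau> \<langle>G e, e\<rangle> + \<tau>\<^sup>2 c \<parallel>G e\<parallel>\<^sup>2 = \<langle>e, N e\<rangle>\<close> with \<open>N = I - \<tau> G (2 I - \<tau> c G)\<close>
  (\<open>isotropic_step_expectation\<close>).

  The matrix \<open>N\<close> is symmetric, so its Rayleigh quotient never exceeds its spectral radius
  (\<open>quadratic_form_le_spectral_radius\<close>), and a step contracts the mean squared error by the factor
  \<open>\<rho>(N)\<close>, whatever the current error is.  Since \<open>v\<^sub>k\<close> is a function of the first \<open>k\<close> directions, it
  is independent of the next one, so Tonelli's theorem lets this bound be averaged over \<open>v\<^sub>k\<close>,
  and induction on \<open>k\<close> finishes the proof.  All expectations of the induction are taken as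
  integrals of nonnegative functions, which need no prior integrability; that the squared error is
  integrable then follows from the bound itself.
\<close>

section \<open>Quadratic forms and the spectral radius\<close>

text \<open>
  The Rayleigh quotient attains its maximum \<open>\<mu>\<close> on the compact unit sphere.  At a maximiser \<open>u\<close> the
  nonnegative form \<open>\<mu> \<parallel>x\<parallel>\<^sup>2 - \<langle>x, N x\<rangle>\<close> attains its minimum 0, so its
  gradient \<open>2 (\<mu> u - N u)\<close> vanishes there.
\<close>

lemma self_adjoint_max_eigenvalue:
  fixes N :: "real^'d^'d"
  assumes sa: "\<And>x y. (N *v x) \<bullet> y = x \<bullet> (N *v y)"
  obtains \<mu> u where "u \<noteq> 0" "N *v u = \<mu> *\<^sub>R u" "\<And>x. x \<bullet> (N *v x) \<le> \<mu> * (norm x)\<^sup>2"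
proof -
  have cont: "continuous_on (sphere 0 1) (\<lambda>x::real^'d. x \<bullet> (N *v x))"
    by (intro continuous_intros matrix_vector_mult_linear_continuous_on)
  have "(axis undefined 1 :: real^'d) \<in> sphere 0 1"
    by simp
  then have "sphere 0 1 \<noteq> ({} :: (real^'d) set)"
    by blast
  then obtain u where u: "u \<in> sphere 0 1"
    and umax: "\<And>x. x \<in> sphere 0 1 \<Longrightarrow> x \<bullet> (N *v x) \<le> u \<bullet> (N *v u)"
    using continuous_attains_sup[OF compact_sphere _ cont] by blast
  define \<mu> where "\<mu> = u \<bullet> (N *v u)"
  have nu: "u \<bullet> u = 1"
    using u by (simp add: dot_square_norm)
  have bound: "x \<bullet> (N *v x) \<le> \<mu> * (norm x)\<^sup>2" for x
  proof (cases "x = 0")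
    case False
    have "(x /\<^sub>R norm x) \<bullet> (N *v (x /\<^sub>R norm x)) \<le> \<mu>"
      unfolding \<mu>_def using False by (intro umax) simp
    moreover have "(x /\<^sub>R norm x) \<bullet> (N *v (x /\<^sub>R norm x)) = (x \<bullet> (N *v x)) / (norm x)\<^sup>2"
      by (simp add: matrix_vector_mult_scaleR power2_eq_square divide_inverse)
    ultimately show ?thesis
      using False by (simp add: pos_divide_le_eq)
  qed simp
  have "N *v u - \<mu> *\<^sub>R u = 0"
  proof (rule ccontr)
    define y where "y = N *v u - \<mu> *\<^sub>R u"
    assume "\<not> N *v u - \<mu> *\<^sub>R u = 0"
    then have ypos: "y \<bullet> y > 0"
      by (simp add: y_def)
    define q where "q = \<mu> * (y \<bullet> y) - y \<bullet> (N *v y)"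
    \<comment> \<open>The form at \<open>u + t y\<close> is \<open>q t\<^sup>2 - 2 \<langle>y, y\<rangle> t\<close>, which is negative for small positive \<open>t\<close>.\<close>
    have ineq: "2 * t * (y \<bullet> y) \<le> t\<^sup>2 * q" for t
    proof -
      have uy: "u \<bullet> (N *v y) = y \<bullet> (N *v u)"
        using sa[of u y] by (simp add: inner_commute)
      have yy: "y \<bullet> (N *v u) = y \<bullet> y + \<mu> * (y \<bullet> u)"
        by (simp add: y_def inner_diff_left inner_diff_right algebra_simps)
      have "(u + t *\<^sub>R y) \<bullet> (N *v (u + t *\<^sub>R y))
          = \<mu> + 2 * t * (y \<bullet> (N *v u)) + t\<^sup>2 * (y \<bullet> (N *v y))"
        by (simp add: matrix_vector_right_distrib matrix_vector_mult_scaleR inner_add_left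
            inner_add_right uy power2_eq_square algebra_simps flip: \<mu>_def)
      moreover have "(norm (u + t *\<^sub>R y))\<^sup>2 = 1 + 2 * t * (y \<bullet> u) + t\<^sup>2 * (y \<bullet> y)"
        unfolding power2_norm_eq_inner
        by (simp add: inner_add_left inner_add_right nu inner_commute[of u y]
            power2_eq_square algebra_simps)
      ultimately show ?thesis
        using bound[of "u + t *\<^sub>R y"] by (simp add: yy q_def algebra_simps)
    qed
    show False
    proof (cases "q \<le> 0")
      case True
      then show False using ineq[of 1] ypos by simp
    next
      case False
      then show False
        using ineq[of "(y \<bullet> y) / q"] mult_pos_pos[OF ypos ypos]
        by (simp add: power2_eq_square field_simps)
    qed
  qed
  moreover have "u \<noteq> 0" using nu by auto
  ultimately show ?thesis
    using that bound by auto
qed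

text \<open>
  Write an eigenvector as \<open>p + i q\<close> and its eigenvalue as \<open>s + i t\<close>.  Then \<open>N p = s p - t q\<close> and
  \<open>N q = s q + t p\<close>, so that \<open>\<langle>N p, q\<rangle> = \<langle>p, N q\<rangle>\<close> forces \<open>t (\<parallel>p\<parallel>\<^sup>2 + \<parallel>q\<parallel>\<^sup>2) = 0\<close>.
\<close>

lemma self_adjoint_complex_eigenvalue_real:
  fixes N :: "real^'d^'d"
  assumes sa: "\<And>x y. (N *v x) \<bullet> y = x \<bullet> (N *v y)"
    and z: "complex_eigenvalue N z"
  obtains s u where "z = complex_of_real s" "u \<noteq> 0" "N *v u = s *\<^sub>R u"
proof -
  obtain w where w: "w \<noteq> 0" "map_matrix complex_of_real N *v w = z *s w"
    using z unfolding complex_eigenvalue_def by blast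
  define p q where "p = (\<chi> i. Re (w $ i))" and "q = (\<chi> i. Im (w $ i))"
  have comp: "(\<Sum>j\<in>UNIV. complex_of_real (N $ i $ j) * w $ j) = z * w $ i" for i
    using arg_cong[OF w(2), of "\<lambda>v. v $ i"] by (simp add: matrix_vector_mult_def)
  have Np: "N *v p = Re z *\<^sub>R p - Im z *\<^sub>R q"
    using arg_cong[OF comp, of Re]
    by (simp add: vec_eq_iff matrix_vector_mult_def p_def q_def)
  have Nq: "N *v q = Re z *\<^sub>R q + Im z *\<^sub>R p"
    using arg_cong[OF comp, of Im]
    by (simp add: vec_eq_iff matrix_vector_mult_def p_def q_def)
  have pq: "p \<noteq> 0 \<or> q \<noteq> 0"
    using w(1) by (auto simp: vec_eq_iff p_def q_def complex_eq_iff)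
  have "Im z * (p \<bullet> p + q \<bullet> q) = 0"
    using sa[of p q]
    by (simp add: Np Nq inner_diff_left inner_add_right algebra_simps)
  moreover have "p \<bullet> p + q \<bullet> q > 0"
    using pq by (auto intro: add_pos_nonneg add_nonneg_pos)
  ultimately have "Im z = 0"
    by simp
  then have "z = complex_of_real (Re z)" "N *v p = Re z *\<^sub>R p" "N *v q = Re z *\<^sub>R q"
    using Np Nq by (auto simp: complex_eq_iff)
  then show ?thesis
    using pq that by blast
qed

text \<open>
  The eigenvalues are real, and real eigenvectors of different eigenvalues are orthogonal, so there
  are at most as many eigenvalues as dimensions.  Finiteness is what makes the maximum in the
  definition of the spectral radius an upper bound.
\<close>

lemma self_adjoint_finite_complex_eigenvalues:
  fixes N :: "real^'d^'d"
  assumes sa: "\<And>x y. (N *v x) \<bullet> y = x \<bullet> (N *v y)"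
  shows "finite {z. complex_eigenvalue N z}"
proof -
  define S where "S = {s. \<exists>u. u \<noteq> 0 \<and> N *v u = s *\<^sub>R u}"
  have "\<forall>s\<in>S. \<exists>u. u \<noteq> 0 \<and> N *v u = s *\<^sub>R u"
    by (simp add: S_def)
  then obtain f where f: "\<And>s. s \<in> S \<Longrightarrow> f s \<noteq> 0 \<and> N *v f s = s *\<^sub>R f s"
    by (auto dest!: bchoice)
  have orth: "f s \<bullet> f t = 0" if "s \<in> S" "t \<in> S" "s \<noteq> t" for s t
    using sa[of "f s" "f t"] f[OF that(1)] f[OF that(2)] that(3) by simp
  have "inj_on f S"
    using orth f by (metis inj_onI inner_eq_zero_iff)
  moreover have "pairwise orthogonal (f ` S)"
    using orth by (auto simp: pairwise_def orthogonal_def)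
  then have "independent (f ` S)"
    using f by (intro pairwise_orthogonal_independent) auto
  then have "finite (f ` S)"
    by (rule independent_imp_finite)
  ultimately have "finite S"
    by (simp add: finite_image_iff)
  moreover have "{z. complex_eigenvalue N z} \<subseteq> complex_of_real ` S"
  proof
    fix z assume "z \<in> {z. complex_eigenvalue N z}"
    then obtain s u where "z = complex_of_real s" "u \<noteq> 0" "N *v u = s *\<^sub>R u"
      using self_adjoint_complex_eigenvalue_real[OF sa] by blast
    then show "z \<in> complex_of_real ` S"
      by (auto simp: S_def)
  qed
  ultimately show ?thesis
    using finite_surj by blast
qed

lemma complex_eigenvalue_of_real:
  fixes N :: "real^'d^'d"
  assumes "u \<noteq> 0" "N *v u = s *\<^sub>R u"
  shows "complex_eigenvalue N (complex_of_real s)"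
proof -
  define w where "w = (\<chi> i. complex_of_real (u $ i))"
  have "(\<Sum>j\<in>UNIV. N $ i $ j * u $ j) = s * u $ i" for i
    using arg_cong[OF assms(2), of "\<lambda>v. v $ i"] by (simp add: matrix_vector_mult_def)
  then have "(\<Sum>j\<in>UNIV. complex_of_real (N $ i $ j) * complex_of_real (u $ j))
      = complex_of_real s * complex_of_real (u $ i)" for i
    by (simp flip: of_real_mult of_real_sum)
  then have "map_matrix complex_of_real N *v w = complex_of_real s *s w"
    by (simp add: vec_eq_iff matrix_vector_mult_def w_def)
  moreover have "w \<noteq> 0"
    using assms(1) by (auto simp: w_def vec_eq_iff)
  ultimately show ?thesis
    unfolding complex_eigenvalue_def by blast
qed

lemma quadratic_form_le_spectral_radius:
  fixes N :: "real^'d^'d"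
  assumes sa: "\<And>x y. (N *v x) \<bullet> y = x \<bullet> (N *v y)"
  shows "x \<bullet> (N *v x) \<le> matrix_spectral_radius N * (norm x)\<^sup>2"
proof -
  obtain \<mu> u where u: "u \<noteq> 0" "N *v u = \<mu> *\<^sub>R u"
    and bound: "\<And>x. x \<bullet> (N *v x) \<le> \<mu> * (norm x)\<^sup>2"
    using self_adjoint_max_eigenvalue[OF sa] by blast
  have "cmod (complex_of_real \<mu>) \<le> matrix_spectral_radius N"
    unfolding matrix_spectral_radius_def
    using self_adjoint_finite_complex_eigenvalues[OF sa] complex_eigenvalue_of_real[OF u]
    by (intro Max_ge finite_imageI imageI) simp_all
  then have "\<mu> \<le> matrix_spectral_radius N"
    by simp
  then show ?thesis
    using bound[of x] by (meson mult_right_mono order_trans zero_le_power2)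
qed

section \<open>Averaging one step over an isotropic direction\<close>

lemma inner_outer_product_mult:
  fixes x :: "real^'d"
  shows "y \<bullet> (outer_product x x *v z) = (y \<bullet> x) * (x \<bullet> z)"
proof -
  have "outer_product x x *v z = (x \<bullet> z) *\<^sub>R x"
    by (simp add: vec_eq_iff outer_product_def matrix_vector_mult_def inner_vec_def
        sum_distrib_left mult_ac)
  then show ?thesis by simp
qed

lemma bounded_linear_matrix_bilinear_form:
  "bounded_linear (\<lambda>T::real^'d^'d. y \<bullet> (T *v z))"
  by (intro linear_conv_bounded_linear[THEN iffD1] linearI)
    (simp_all add: matrix_vector_mult_add_rdistrib inner_add_right scaleR_matrix_vector_assoc[symmetric])

text \<open>
  A bilinear form in the direction is a bounded linear functional of its outer product, and such a
  functional commutes with the matrix-valued integrals in the definition of isotropy.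
\<close>

lemma isotropic_second_moment:
  fixes y z :: "real^'d"
  assumes "isotropic D c"
  shows "has_bochner_integral D (\<lambda>x. (y \<bullet> x) * (x \<bullet> z)) (y \<bullet> z)"
proof -
  have "has_bochner_integral D (\<lambda>x. outer_product x x) (mat 1 :: real^'d^'d)"
    using assms by (simp add: isotropic_def has_bochner_integral_iff)
  from has_bochner_integral_bounded_linear[OF bounded_linear_matrix_bilinear_form[of y z] this]
  show ?thesis by (simp add: inner_outer_product_mult)
qed

lemma isotropic_fourth_moment:
  fixes y z :: "real^'d"
  assumes "isotropic D c"
  shows "has_bochner_integral D (\<lambda>x. (norm x)\<^sup>2 * ((y \<bullet> x) * (x \<bullet> z))) (c * (y \<bullet> z))"
proof -
  have "has_bochner_integral D (\<lambda>x. (norm x)\<^sup>2 *\<^sub>R outer_product x x) (c *\<^sub>R mat 1 :: real^'d^'d)"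
    using assms by (simp add: isotropic_def has_bochner_integral_iff)
  from has_bochner_integral_bounded_linear[OF bounded_linear_matrix_bilinear_form[of y z] this]
  show ?thesis
    by (simp add: inner_outer_product_mult scaleR_matrix_vector_assoc[symmetric])
qed

definition error_step :: "real^'d^'m \<Rightarrow> real \<Rightarrow> real^'d \<Rightarrow> real^'d \<Rightarrow> real^'d" where
  "error_step A \<tau> e x = e - (\<tau> * ((A *v e) \<bullet> (A *v x))) *\<^sub>R x"

definition error_matrix :: "real^'d^'m \<Rightarrow> real \<Rightarrow> real \<Rightarrow> real^'d^'d" where
  "error_matrix A \<tau> c = mat 1 - \<tau> *\<^sub>R ((transpose A ** A)
     ** (2 *\<^sub>R mat 1 - (\<tau> * c) *\<^sub>R (transpose A ** A)))"

lemma sgdas_error: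
  assumes "A *v vhat = b"
  shows "sgdas A b \<tau> x (Suc k) - vhat = error_step A (\<tau> k) (sgdas A b \<tau> x k - vhat) (x k)"
  using assms by (simp add: error_step_def matrix_vector_mult_diff_distrib)

lemma inner_gram_mult:
  fixes A :: "real^'d^'m"
  shows "((transpose A ** A) *v x) \<bullet> y = (A *v x) \<bullet> (A *v y)"
  by (simp add: matrix_vector_mul_assoc[symmetric] transpose_matrix_vector dot_lmul_matrix)

lemma error_matrix_inner:
  fixes A :: "real^'d^'m"
  defines "G \<equiv> transpose A ** A"
  shows "x \<bullet> (error_matrix A \<tau> c *v y)
     = x \<bullet> y - 2 * \<tau> * ((G *v x) \<bullet> y) + \<tau>\<^sup>2 * c * ((G *v x) \<bullet> (G *v y))"
proof -
  have G_sa: "x \<bullet> (G *v y) = (G *v x) \<bullet> y" for x y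
    unfolding G_def by (metis inner_gram_mult inner_commute)
  have "error_matrix A \<tau> c *v y = y - \<tau> *\<^sub>R (G *v (2 *\<^sub>R y - (\<tau> * c) *\<^sub>R (G *v y)))"
    by (simp add: error_matrix_def matrix_vector_mult_diff_rdistrib
        scaleR_matrix_vector_assoc[symmetric] matrix_vector_mul_assoc[symmetric] flip: G_def)
  also have "\<dots> = y - (2 * \<tau>) *\<^sub>R (G *v y) + (\<tau>\<^sup>2 * c) *\<^sub>R (G *v (G *v y))"
    by (simp add: matrix_vector_mult_diff_distrib matrix_vector_mult_scaleR scaleR_diff_right
        power2_eq_square mult_ac)
  finally show ?thesis
    by (simp add: inner_diff_right inner_add_right G_sa[of x])
qed

lemma error_matrix_self_adjoint:
  "(error_matrix A \<tau> c *v x) \<bullet> y = x \<bullet> (error_matrix A \<tau> c *v y)"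
proof -
  let ?G = "transpose A ** A"
  have "(?G *v y) \<bullet> x = (?G *v x) \<bullet> y"
    by (metis inner_gram_mult inner_commute)
  moreover have "(?G *v y) \<bullet> (?G *v x) = (?G *v x) \<bullet> (?G *v y)" "y \<bullet> x = x \<bullet> y"
    by (rule inner_commute)+
  ultimately have "y \<bullet> (error_matrix A \<tau> c *v x) = x \<bullet> (error_matrix A \<tau> c *v y)"
    by (simp only: error_matrix_inner)
  then show ?thesis
    by (simp only: inner_commute[of y])
qed

lemma isotropic_step_expectation:
  fixes A :: "real^'d^'m"
  assumes "isotropic D c" "prob_space D"
  shows "has_bochner_integral D (\<lambda>x. (norm (error_step A \<tau> e x))\<^sup>2)
     (e \<bullet> (error_matrix A \<tau> c *v e))"
proof -
  interpret D: prob_space D by fact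
  define g where "g = (transpose A ** A) *v e"
  have "(norm (error_step A \<tau> e x))\<^sup>2 =
      e \<bullet> e - 2 * \<tau> * ((g \<bullet> x) * (x \<bullet> e)) + \<tau>\<^sup>2 * ((norm x)\<^sup>2 * ((g \<bullet> x) * (x \<bullet> g)))" for x
    unfolding error_step_def inner_gram_mult[symmetric] g_def[symmetric] power2_norm_eq_inner
    by (simp add: inner_diff_left inner_diff_right inner_commute[of x g] inner_commute[of x e])
      (simp add: power2_eq_square algebra_simps)
  moreover have "e \<bullet> (error_matrix A \<tau> c *v e)
      = e \<bullet> e - 2 * \<tau> * (g \<bullet> e) + \<tau>\<^sup>2 * (c * (g \<bullet> g))"
    by (simp add: error_matrix_inner g_def)
  moreover have "has_bochner_integral D (\<lambda>x. e \<bullet> e) (e \<bullet> e)"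
    by (simp add: has_bochner_integral_iff D.prob_space)
  ultimately show ?thesis
    by (simp only:) (intro has_bochner_integral_add has_bochner_integral_diff
        has_bochner_integral_mult_right isotropic_second_moment[OF assms(1)]
        isotropic_fourth_moment[OF assms(1)])
qed

lemma isotropic_step_contracts:
  fixes A :: "real^'d^'m"
  assumes "isotropic D c" "prob_space D"
  shows "(\<integral>\<^sup>+x. ennreal ((norm (error_step A \<tau> e x))\<^sup>2) \<partial>D)
     \<le> ennreal (matrix_spectral_radius (error_matrix A \<tau> c) * (norm e)\<^sup>2)"
proof -
  have "(\<integral>\<^sup>+x. ennreal ((norm (error_step A \<tau> e x))\<^sup>2) \<partial>D)
      = ennreal (e \<bullet> (error_matrix A \<tau> c *v e))"
    using isotropic_step_expectation[OF assms, of A \<tau> e]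
    by (simp add: has_bochner_integral_iff nn_integral_eq_integral)
  also have "\<dots> \<le> ennreal (matrix_spectral_radius (error_matrix A \<tau> c) * (norm e)\<^sup>2)"
    by (intro ennreal_leI quadratic_form_le_spectral_radius error_matrix_self_adjoint)
  finally show ?thesis .
qed

section \<open>Independence of the iterate and the next direction\<close>

text \<open>
  The iterates up to the \<open>n\<close>-th live on one product space \<open>{..<n}\<close>, which stays the same throughout
  the induction on \<open>k\<close>.
\<close>

lemma measurable_sgdas:
  fixes A :: "real^'d^'m"
  assumes "k \<le> n"
  shows "(\<lambda>x. sgdas A b \<tau> x k) \<in> borel_measurable (PiM {..<n} (\<lambda>_. borel))"
  using assms
proof (induction k)
  case (Suc k)
  have [measurable]: "(\<lambda>x. x k) \<in> borel_measurable (PiM {..<n} (\<lambda>_. borel :: (real^'d) measure))"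
    using Suc.prems by (intro measurable_component_singleton) auto
  have [measurable]: "(\<lambda>y. A *v y) \<in> borel_measurable borel"
    by (intro borel_measurable_continuous_onI matrix_vector_mult_linear_continuous_on)
  note Suc.IH[OF Suc_leD[OF Suc.prems], measurable]
  show ?case by simp
qed simp

lemma sgdas_cong:
  "(\<And>i. i < k \<Longrightarrow> x i = y i) \<Longrightarrow> sgdas A b \<tau> x k = sgdas A b \<tau> y k"
  by (induction k) simp_all

lemma (in prob_space) indep_var_sgdas:
  fixes X :: "nat \<Rightarrow> 'a \<Rightarrow> real^'d"
  assumes "indep_vars (\<lambda>_. borel) X UNIV"
  shows "indep_var borel (\<lambda>\<omega>. sgdas A b \<tau> (\<lambda>i. X i \<omega>) k) borel (X k)"
proof -
  have "indep_var borel ((\<lambda>x. sgdas A b \<tau> x k) \<circ> (\<lambda>\<omega>. restrict (\<lambda>i. X i \<omega>) {..<k}))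
      borel ((\<lambda>x. x k) \<circ> (\<lambda>\<omega>. restrict (\<lambda>i. X i \<omega>) {k}))"
    using measurable_sgdas[of k k]
    by (intro indep_var_compose[OF indep_var_restrict[OF assms]]) auto
  moreover have "sgdas A b \<tau> (restrict (\<lambda>i. X i \<omega>) {..<k}) k = sgdas A b \<tau> (\<lambda>i. X i \<omega>) k" for \<omega>
    by (rule sgdas_cong) simp
  ultimately show ?thesis
    by (simp add: comp_def)
qed

text \<open>Tonelli's theorem for the joint law of two independent variables, which is a product.\<close>

lemma (in prob_space) nn_integral_indep_var:
  assumes ind: "indep_var S Y T Z" and f: "f \<in> borel_measurable (S \<Otimes>\<^sub>M T)"
  shows "(\<integral>\<^sup>+\<omega>. f (Y \<omega>, Z \<omega>) \<partial>M) = (\<integral>\<^sup>+\<omega>. (\<integral>\<^sup>+z. f (Y \<omega>, z) \<partial>distr M T Z) \<partial>M)"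
proof -
  have Y [measurable]: "random_variable S Y" and Z [measurable]: "random_variable T Z"
    and joint: "distr M S Y \<Otimes>\<^sub>M distr M T Z = distr M (S \<Otimes>\<^sub>M T) (\<lambda>\<omega>. (Y \<omega>, Z \<omega>))"
    using ind by (auto simp: indep_var_distribution_eq)
  interpret Z: prob_space "distr M T Z"
    by (rule prob_space_distr) fact
  note f [measurable]
  have "(\<integral>\<^sup>+\<omega>. f (Y \<omega>, Z \<omega>) \<partial>M) = (\<integral>\<^sup>+p. f p \<partial>(distr M S Y \<Otimes>\<^sub>M distr M T Z))"
    unfolding joint by (simp add: nn_integral_distr)
  also have "\<dots> = (\<integral>\<^sup>+y. (\<integral>\<^sup>+z. f (y, z) \<partial>distr M T Z) \<partial>distr M S Y)"
    by (subst Z.nn_integral_fst) simp_all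
  also have "\<dots> = (\<integral>\<^sup>+\<omega>. (\<integral>\<^sup>+z. f (Y \<omega>, z) \<partial>distr M T Z) \<partial>M)"
    by (subst nn_integral_distr) simp_all
  finally show ?thesis .
qed

section \<open>Convergence of the mean squared error\<close>

lemma (in prob_space) sgdas_mean_square_error_le:
  fixes A :: "real^'d^'m" and X :: "nat \<Rightarrow> 'a \<Rightarrow> real^'d"
  assumes sol: "A *v vhat = b"
    and ind: "indep_vars (\<lambda>_. borel) X UNIV"
    and D: "\<And>k. distr M borel (X k) = D" and iso: "isotropic D c"
    and lam: "lam = matrix_spectral_radius (error_matrix A \<tau> c)" "0 \<le> lam"
  shows "(\<integral>\<^sup>+\<omega>. ennreal ((norm (sgdas A b (\<lambda>_. \<tau>) (\<lambda>i. X i \<omega>) k - vhat))\<^sup>2) \<partial>M)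
     \<le> ennreal (lam ^ k * (norm (0 - vhat))\<^sup>2)"
proof (induction k)
  case 0
  then show ?case by (simp add: emeasure_space_1)
next
  case (Suc k)
  define V where "V = (\<lambda>\<omega>. sgdas A b (\<lambda>_. \<tau>) (\<lambda>i. X i \<omega>) k)"
  have indV: "indep_var borel V borel (X k)"
    unfolding V_def by (rule indep_var_sgdas[OF ind])
  then have [measurable]: "random_variable borel V" "random_variable borel (X k)"
    by (auto simp: indep_var_distribution_eq)
  have psD: "prob_space D"
    unfolding D[of k, symmetric] by (rule prob_space_distr) measurable
  have [measurable]: "(\<lambda>y. A *v y) \<in> borel_measurable borel"
    by (intro borel_measurable_continuous_onI matrix_vector_mult_linear_continuous_on)
  have meas: "(\<lambda>(v, x). ennreal ((norm (error_step A \<tau> (v - vhat) x))\<^sup>2))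
      \<in> borel_measurable (borel \<Otimes>\<^sub>M borel)"
    unfolding error_step_def by measurable
  have "(\<integral>\<^sup>+\<omega>. ennreal ((norm (sgdas A b (\<lambda>_. \<tau>) (\<lambda>i. X i \<omega>) (Suc k) - vhat))\<^sup>2) \<partial>M)
      = (\<integral>\<^sup>+\<omega>. ennreal ((norm (error_step A \<tau> (V \<omega> - vhat) (X k \<omega>)))\<^sup>2) \<partial>M)"
    by (simp only: sgdas_error[OF sol] V_def)
  also have "\<dots> = (\<integral>\<^sup>+\<omega>. (\<integral>\<^sup>+x. ennreal ((norm (error_step A \<tau> (V \<omega> - vhat) x))\<^sup>2) \<partial>D) \<partial>M)"
    using nn_integral_indep_var[OF indV meas] by (simp add: D)
  also have "\<dots> \<le> (\<integral>\<^sup>+\<omega>. ennreal lam * ennreal ((norm (V \<omega> - vhat))\<^sup>2) \<partial>M)"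
    using isotropic_step_contracts[OF iso psD, of A \<tau>] lam
    by (intro nn_integral_mono) (simp add: ennreal_mult)
  also have "\<dots> = ennreal lam * (\<integral>\<^sup>+\<omega>. ennreal ((norm (V \<omega> - vhat))\<^sup>2) \<partial>M)"
    by (intro nn_integral_cmult) measurable
  also have "\<dots> \<le> ennreal lam * ennreal (lam ^ k * (norm (0 - vhat))\<^sup>2)"
    using Suc.IH unfolding V_def by (intro mult_left_mono) simp_all
  also have "\<dots> = ennreal (lam ^ Suc k * (norm (0 - vhat))\<^sup>2)"
    using lam(2) by (simp add: ennreal_mult mult.assoc)
  finally show ?case .
qed

theorem theorem3p4:
  fixes A :: "real^'d^'m" and b :: "real^'m" and vhat :: "real^'d"
    and M :: "'a measure" and X :: "nat \<Rightarrow> 'a \<Rightarrow> real^'d" and D :: "(real^'d) measure"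
    and c \<tau> lam :: real and v :: "nat \<Rightarrow> 'a \<Rightarrow> real^'d"
  assumes "A \<noteq> 0"
    and "\<exists>u. A *v u = b"
    and "A *v vhat = b"
    and "prob_space M"
    and "prob_space.indep_vars M (\<lambda>_. borel) X UNIV"
    and "\<And>k. distr M borel (X k) = D"
    and "isotropic D c"
    and "\<And>k \<omega>. v k \<omega> = sgdas A b (\<lambda>_. \<tau>) (\<lambda>i. X i \<omega>) k"
    and "0 < \<tau>" and "\<tau> < 2 / (c * (spectral_norm A)\<^sup>2)"
    and "lam = matrix_spectral_radius
           (mat 1 - \<tau> *\<^sub>R ((transpose A ** A)
              ** (2 *\<^sub>R mat 1 - (\<tau> * c) *\<^sub>R (transpose A ** A))))"
    and "lam \<in> {0..<1}"
  shows "\<forall>k. integrable M (\<lambda>\<omega>. (norm (v (Suc k) \<omega> - vhat))\<^sup>2) \<and>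
             prob_space.expectation M (\<lambda>\<omega>. (norm (v (Suc k) \<omega> - vhat))\<^sup>2)
               \<le> lam ^ (Suc k) * (norm (0 - vhat))\<^sup>2"
proof
  fix k
  interpret prob_space M by fact
  let ?f = "\<lambda>\<omega>. (norm (v (Suc k) \<omega> - vhat))\<^sup>2"
  have "indep_var borel (v (Suc k)) borel (X (Suc k))"
    using indep_var_sgdas[OF assms(5), of A b "\<lambda>_. \<tau>" "Suc k"] by (simp only: assms(8)[abs_def])
  then have [measurable]: "random_variable borel (v (Suc k))"
    by (auto simp: indep_var_distribution_eq)
  have lam: "lam = matrix_spectral_radius (error_matrix A \<tau> c)" "0 \<le> lam"
    using assms(11,12) by (simp_all add: error_matrix_def)
  have bound: "(\<integral>\<^sup>+\<omega>. ennreal (?f \<omega>) \<partial>M) \<le> ennreal (lam ^ Suc k * (norm (0 - vhat))\<^sup>2)"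
    unfolding assms(8) by (rule sgdas_mean_square_error_le[OF assms(3,5,6,7) lam])
  have int: "integrable M ?f"
    using bound by (intro integrableI_bounded) (auto intro: le_less_trans)
  moreover have "expectation ?f \<le> lam ^ Suc k * (norm (0 - vhat))\<^sup>2"
    using bound lam(2) by (simp add: nn_integral_eq_integral[OF int] del: power_Suc)
  ultimately show "integrable M ?f \<and> expectation ?f \<le> lam ^ Suc k * (norm (0 - vhat))\<^sup>2"
    by blast
qed

end
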